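(* Let $\{a_n\}_{n\ge0}$ and $\{b_n\}_{n\ge0}$ be the sequences satisfying, for all $n\ge0$, $$(n+2)^3u_{n+2}-8(2n+3)(2n^2+6n+5)u_{n+1}+256(n+1)^3u_n=0\quad(u_n=a_n\text{ or }b_n)$$ with initial values $a_0=1$, $a_1=8$, $b_0=0$, $b_1=1$. Then $$\left|\frac{b_n}{a_n}-\frac7{16}\zeta(3)\right|\ll\frac1{\log n}$$ as $n\to\infty$.
   Context: $\zeta$ is the Riemann zeta function. $X_n\ll Y_n$ means $|X_n|\le CY_n$ for some constant $C$ and all large $n$. *)

theory Defs
  imports "HOL-Complex_Analysis.Complex_Analysis"
begin

definition zeta_series :: "complex \<Rightarrow> complex" where
  "zeta_series s = (\<Sum>n. 1 / of_nat (Suc n) powr s)"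

text \<open>
  The Riemann zeta function: the Dirichlet series on the half-plane \<open>Re s > 1\<close>, and its
  analytic continuation elsewhere. By the identity theorem the continuation is unique on
  \<open>- {1}\<close>; the value at the pole \<open>1\<close> is unspecified.
\<close>

definition riemann_zeta :: "complex \<Rightarrow> complex" where
  "riemann_zeta s =
     (if Re s > 1 then zeta_series s
      else (SOME f. f holomorphic_on - {1} \<and> (\<forall>w. Re w > 1 \<longrightarrow> f w = zeta_series w)) s)"

end

theory Submission
  imports Defs "HOL-Real_Asymp.Real_Asymp"
begin

text \<open>
  Let \<open>R\<^sub>n(t) = ((t - 1/2) \<cdots> (t - n + 1/2) / (t (t - 1) \<cdots> (t - n)))\<^sup>2\<close>, the well-poised
  summand whose double-pole coefficients at \<open>t = k\<close> are the summands of
  \<open>a\<^sub>n / 16\<^sup>n = (\<Sum>k\<le>n. (p\<^sub>k p\<^sub>n\<^sub>-\<^sub>k)\<^sup>2)\<close>, where \<open>p\<^sub>k = binom(2k, k) / 4\<^sup>k\<close>.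
  A single creative-telescoping certificate shows that both this sum and
  \<open>d\<^sub>n = - 1/2 (\<Sum>\<nu>\<ge>0. R\<^sub>n'(\<nu> + 1/2))\<close> satisfy the recurrence (rescaled by \<open>16\<^sup>n\<close>). Comparing
  initial values, \<open>7/16 \<zeta>(3) a\<^sub>n - b\<^sub>n = 16\<^sup>n d\<^sub>n / 16\<close>. Since \<open>R\<^sub>n\<close> has double zeros at
  \<open>1/2, \<dots>, n - 1/2\<close>, only \<open>\<nu> \<ge> n\<close> contributes to \<open>d\<^sub>n\<close>, which gives \<open>d\<^sub>n = O(1 / n)\<close>,
  while \<open>p\<^sub>k\<^sup>2 \<ge> 1 / (4 k)\<close> gives \<open>a\<^sub>n / 16\<^sup>n \<ge> log n / (16 n)\<close>.
\<close>

section \<open>The creative-telescoping identity\<close>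

text \<open>After division by \<open>w\<^sup>2\<close> this is a polynomial identity in
  \<open>n\<close> and \<open>t\<close>. The free factor \<open>w\<close> lets it serve twice: for
  \<open>kernel\<close> at non-integral \<open>t\<close>, and for the products of
  \<open>binom_ratio\<close> at integers \<open>t = k\<close>.\<close>

lemma telescoping_certificate:
  fixes n t w :: real
  defines "Q \<equiv> \<lambda>t. (4 * n + 5) * (n + 2) / 2 - (2 * n + 3) * t"
  shows "2 * (n + 2)^3 * ((t - n - 1/2) * (t - n - 3/2) * w)\<^sup>2
         - (2 * n + 3) * (2 * n^2 + 6 * n + 5) * ((t - n - 1/2) * (t - n - 2) * w)\<^sup>2
         + 2 * (n + 1)^3 * ((t - n - 1) * (t - n - 2) * w)\<^sup>2
       = Q (t + 1) * ((t + 1/2) * (t - n - 2) * w)\<^sup>2 - Q t * (t * (t - n - 1/2) * w)\<^sup>2"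
proof -
  have "2 * (n + 2)^3 * ((t - n - 1/2) * (t - n - 3/2))\<^sup>2
         - (2 * n + 3) * (2 * n^2 + 6 * n + 5) * ((t - n - 1/2) * (t - n - 2))\<^sup>2
         + 2 * (n + 1)^3 * ((t - n - 1) * (t - n - 2))\<^sup>2
       = Q (t + 1) * ((t + 1/2) * (t - n - 2))\<^sup>2 - Q t * (t * (t - n - 1/2))\<^sup>2"
    (is "?l = ?r")
    unfolding Q_def by (simp add: field_simps power2_eq_square power3_eq_cube)
  moreover have "A * (x1 * w)\<^sup>2 - B * (x2 * w)\<^sup>2 + C * (x3 * w)\<^sup>2 = D * (x4 * w)\<^sup>2 - E * (x5 * w)\<^sup>2"
    if "A * x1\<^sup>2 - B * x2\<^sup>2 + C * x3\<^sup>2 = D * x4\<^sup>2 - E * x5\<^sup>2" for A B C D E x1 x2 x3 x4 x5 :: real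
    using arg_cong[OF that, of "\<lambda>s. s * w\<^sup>2"] by (simp add: power_mult_distrib algebra_simps)
  ultimately show ?thesis by blast
qed

section \<open>The kernel and its telescoping at half-integers\<close>

text \<open>The square root of \<open>R\<^sub>n\<close>; the double zeros and double poles of
  \<open>R\<^sub>n\<close> become simple ones.\<close>

definition kernel :: "nat \<Rightarrow> real \<Rightarrow> real" where
  "kernel n t = (\<Prod>j<n. t - real j - 1/2) / (\<Prod>j\<le>n. t - real j)"

lemma kernel_0: "kernel 0 t = 1 / t"
  by (simp add: kernel_def)

lemma kernel_Suc: "kernel (Suc n) t = kernel n t * ((t - real n - 1/2) / (t - real n - 1))"
  by (simp add: kernel_def algebra_simps)

lemma kernel_zero:
  assumes "\<nu> < n"
  shows "kernel n (real \<nu> + 1/2) = 0"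
  using assms by (auto simp: kernel_def)

lemma diff_of_nat_nonzero:
  fixes t :: real
  assumes "t \<notin> \<int>"
  shows "t - real k \<noteq> 0" "t - real k - 1 \<noteq> 0" "t - real k - 2 \<noteq> 0"
proof -
  have *: "t \<noteq> of_int m" for m using assms by auto
  show "t - real k \<noteq> 0" "t - real k - 1 \<noteq> 0" "t - real k - 2 \<noteq> 0"
    using *[of "int k"] *[of "int k + 1"] *[of "int k + 2"] by auto
qed

lemma not_Ints_nonzero:
  fixes t :: real
  assumes "t \<notin> \<int>"
  shows "t \<noteq> 0" "t + 1 \<noteq> 0"
proof -
  have *: "t \<noteq> of_int m" for m using assms by auto
  show "t \<noteq> 0" "t + 1 \<noteq> 0" using *[of 0] *[of "-1"] by auto
qed

lemma half_nat_not_Ints: "real \<nu> + 1/2 \<notin> \<int>"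
proof
  assume "real \<nu> + 1/2 \<in> \<int>"
  then obtain m where "real \<nu> + 1/2 = of_int m" by (auto elim: Ints_cases)
  then have "real_of_int (2 * int \<nu> + 1) = real_of_int (2 * m)" by simp
  then have "2 * int \<nu> + 1 = 2 * m" by (simp only: of_int_eq_iff)
  then show False by presburger
qed

text \<open>The shift quotient of the kernel, multiplied out because \<open>t - n + 1/2\<close> may
  vanish at a half-integer, and half-integers are where it is applied.\<close>

lemma kernel_shift:
  assumes "t \<notin> \<int>"
  shows "kernel n (t + 1) * ((t - real n + 1/2) * (t + 1)) = kernel n t * ((t + 1/2) * (t - real n))"
proof (induction n)
  case 0
  then show ?case using not_Ints_nonzero[OF assms] diff_of_nat_nonzero[OF assms, of 0] by (simp add: kernel_0 field_simps)
next
  case (Suc n)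
  note nz = not_Ints_nonzero[OF assms] diff_of_nat_nonzero[OF assms, of n]
  have "kernel (Suc n) (t + 1) * ((t - real (Suc n) + 1/2) * (t + 1))
      = kernel n (t + 1) * ((t - real n + 1/2) * (t + 1)) * ((t - real n - 1/2) / (t - real n))"
    using nz by (simp add: kernel_Suc field_simps)
  also have "\<dots> = kernel (Suc n) t * ((t + 1/2) * (t - real (Suc n)))"
    unfolding Suc using nz by (simp add: kernel_Suc divide_simps) (simp add: algebra_simps)
  finally show ?case .
qed

text \<open>
  The antidifference of the recurrence applied to \<open>R\<^sub>n = (kernel n)\<^sup>2\<close> is
  \<open>telescoper_factor n t * (telescoper_root n t)\<^sup>2\<close>; it is obtained from Gosper's algorithm.
\<close>

definition telescoper_root :: "nat \<Rightarrow> real \<Rightarrow> real" where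
  "telescoper_root n t = kernel n t * (t * (t - real n - 1/2) / ((t - real n - 1) * (t - real n - 2)))"

definition telescoper_factor :: "nat \<Rightarrow> real \<Rightarrow> real" where
  "telescoper_factor n t = (4 * real n + 5) * (real n + 2) / 2 - (2 * real n + 3) * t"

lemma kernel_telescope:
  assumes "t \<notin> \<int>"
  shows "2 * (real n + 2)^3 * (kernel (n + 2) t)\<^sup>2
         - (2 * real n + 3) * (2 * (real n)^2 + 6 * real n + 5) * (kernel (n + 1) t)\<^sup>2
         + 2 * (real n + 1)^3 * (kernel n t)\<^sup>2
       = telescoper_factor n (t + 1) * (telescoper_root n (t + 1))\<^sup>2 - telescoper_factor n t * (telescoper_root n t)\<^sup>2"
proof -
  note nz = not_Ints_nonzero[OF assms] diff_of_nat_nonzero[OF assms, of n]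
  \<comment> \<open>With the next two poles \<open>n + 1\<close> and \<open>n + 2\<close> put into
    the denominator, the three kernels and both values of \<open>telescoper_root\<close> become
    polynomial multiples of the same \<open>w\<close>.\<close>
  define w where "w = kernel n t / ((t - real n - 1) * (t - real n - 2))"
  have k0: "kernel n t = (t - real n - 1) * (t - real n - 2) * w"
    using nz by (simp add: w_def)
  have k1: "kernel (n + 1) t = (t - real n - 1/2) * (t - real n - 2) * w"
    using nz by (simp add: w_def kernel_Suc)
  have k2: "kernel (n + 2) t = (t - real n - 1/2) * (t - real n - 3/2) * w"
    using nz by (simp add: w_def kernel_Suc numeral_2_eq_2 diff_diff_eq add.commute mult_ac)
  have g0: "telescoper_root n t = t * (t - real n - 1/2) * w"
    by (simp add: telescoper_root_def w_def)
  have "telescoper_root n (t + 1) = kernel n (t + 1) * ((t - real n + 1/2) * (t + 1)) / ((t - real n) * (t - real n - 1))"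
    by (simp add: telescoper_root_def algebra_simps)
  also have "\<dots> = (t + 1/2) * (t - real n - 2) * w"
    unfolding kernel_shift[OF assms] w_def using nz by (simp add: divide_simps)
  finally have g1: "telescoper_root n (t + 1) = (t + 1/2) * (t - real n - 2) * w" .
  show ?thesis
    unfolding k0 k1 k2 g0 g1 telescoper_factor_def by (rule telescoping_certificate)
qed

lemma kernel_differentiable:
  assumes "t \<notin> \<int>"
  shows "kernel n field_differentiable at t"
proof (induction n)
  case 0
  have "kernel 0 = (\<lambda>t. 1 / t)" by (simp add: kernel_0 fun_eq_iff)
  then show ?case using not_Ints_nonzero[OF assms] diff_of_nat_nonzero[OF assms]
    by (auto intro!: derivative_intros field_differentiable_divide)
next
  case (Suc n)
  have "kernel (Suc n) = (\<lambda>t. kernel n t * ((t - real n - 1/2) / (t - real n - 1)))"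
    by (simp add: kernel_Suc fun_eq_iff)
  then show ?case using not_Ints_nonzero[OF assms] diff_of_nat_nonzero[OF assms] Suc
    by (auto intro!: derivative_intros field_differentiable_mult field_differentiable_divide
        field_differentiable_diff)
qed

lemma telescoper_root_differentiable:
  assumes "t \<notin> \<int>"
  shows "telescoper_root n field_differentiable at t"
proof -
  have "telescoper_root n = (\<lambda>t. kernel n t * (t * (t - real n - 1/2) / ((t - real n - 1) * (t - real n - 2))))"
    by (simp add: telescoper_root_def fun_eq_iff)
  then show ?thesis using not_Ints_nonzero[OF assms] diff_of_nat_nonzero[OF assms] kernel_differentiable[OF assms]
    by (auto intro!: derivative_intros field_differentiable_mult field_differentiable_divide
        field_differentiable_diff)
qed

text \<open>This is \<open>- 1/2 R\<^sub>n'(\<nu> + 1/2)\<close>, since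
  \<open>R\<^sub>n' = 2 * kernel n * deriv (kernel n)\<close>.\<close>

definition slope_term :: "nat \<Rightarrow> nat \<Rightarrow> real" where
  "slope_term n \<nu> = - kernel n (real \<nu> + 1/2) * deriv (kernel n) (real \<nu> + 1/2)"

text \<open>Half the derivative of the antidifference
  \<open>telescoper_factor n t * (telescoper_root n t)\<^sup>2\<close>, matching the factor 1/2 in
  \<open>slope_term\<close>.\<close>

definition telescoper_slope :: "nat \<Rightarrow> real \<Rightarrow> real" where
  "telescoper_slope n t = telescoper_factor n t * (telescoper_root n t * deriv (telescoper_root n) t) - (2 * real n + 3) / 2 * (telescoper_root n t)\<^sup>2"

lemma telescoper_derivative:
  assumes "t \<notin> \<int>"
  shows "((\<lambda>t. telescoper_factor n t * (telescoper_root n t)\<^sup>2) has_real_derivative 2 * telescoper_slope n t) (at t)"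
proof -
  have "(telescoper_root n has_real_derivative deriv (telescoper_root n) t) (at t)"
    using telescoper_root_differentiable[OF assms] field_differentiable_derivI by blast
  moreover have "(telescoper_factor n has_real_derivative - (2 * real n + 3)) (at t)"
    unfolding telescoper_factor_def by (auto intro!: derivative_eq_intros)
  ultimately show ?thesis
    by (auto intro!: derivative_eq_intros simp: telescoper_slope_def algebra_simps power2_eq_square)
qed

text \<open>Differentiate \<open>kernel_telescope\<close> at \<open>\<nu> + 1/2\<close> and divide
  by -2; the sign reverses the difference on the right.\<close>

lemma slope_term_telescope:
  "2 * (real n + 2)^3 * slope_term (n + 2) \<nu>
     - (2 * real n + 3) * (2 * (real n)^2 + 6 * real n + 5) * slope_term (n + 1) \<nu>
     + 2 * (real n + 1)^3 * slope_term n \<nu>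
   = telescoper_slope n (real \<nu> + 1/2) - telescoper_slope n (real (Suc \<nu>) + 1/2)"
proof -
  define t where "t = real \<nu> + 1/2"
  define A where "A = 2 * (real n + 2)^3"
  define B where "B = (2 * real n + 3) * (2 * (real n)^2 + 6 * real n + 5)"
  define C where "C = 2 * (real n + 1)^3"
  have t: "t \<notin> \<int>" unfolding t_def by (rule half_nat_not_Ints)
  have t1: "t + 1 \<notin> \<int>"
    using half_nat_not_Ints[of "Suc \<nu>"] by (simp add: t_def algebra_simps)
  have K: "(kernel m has_real_derivative deriv (kernel m) t) (at t)" for m
    using kernel_differentiable[OF t] field_differentiable_derivI by blast
  have L: "((\<lambda>x. A * (kernel (n + 2) x)\<^sup>2 - B * (kernel (n + 1) x)\<^sup>2 + C * (kernel n x)\<^sup>2) has_real_derivative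
      A * (2 * (kernel (n + 2) t * deriv (kernel (n + 2)) t)) - B * (2 * (kernel (n + 1) t * deriv (kernel (n + 1)) t))
      + C * (2 * (kernel n t * deriv (kernel n) t))) (at t)"
    using K[of n] K[of "n + 1"] K[of "n + 2"]
    by (auto intro!: derivative_eq_intros simp: algebra_simps)
  have R: "((\<lambda>x. telescoper_factor n (x + 1) * (telescoper_root n (x + 1))\<^sup>2 - telescoper_factor n x * (telescoper_root n x)\<^sup>2) has_real_derivative
      2 * telescoper_slope n (t + 1) - 2 * telescoper_slope n t) (at t)"
    using DERIV_shift[THEN iffD1, OF telescoper_derivative[OF t1, of n]]
      telescoper_derivative[OF t, of n]
    by (intro DERIV_diff) auto
  \<comment> \<open>The complement of the integers is open, so the identity holds on a neighbourhood
    of \<open>t\<close> and may be differentiated there.\<close>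
  have ev: "\<forall>\<^sub>F x in nhds t. A * (kernel (n + 2) x)\<^sup>2 - B * (kernel (n + 1) x)\<^sup>2 + C * (kernel n x)\<^sup>2
      = telescoper_factor n (x + 1) * (telescoper_root n (x + 1))\<^sup>2 - telescoper_factor n x * (telescoper_root n x)\<^sup>2"
    unfolding eventually_nhds A_def B_def C_def using t kernel_telescope
    by (intro exI[of _ "- \<int>"]) (auto simp: open_Compl)
  have "A * (2 * (kernel (n + 2) t * deriv (kernel (n + 2)) t)) - B * (2 * (kernel (n + 1) t * deriv (kernel (n + 1)) t))
      + C * (2 * (kernel n t * deriv (kernel n) t)) = 2 * telescoper_slope n (t + 1) - 2 * telescoper_slope n t"
    using L R DERIV_cong_ev[OF refl ev refl] DERIV_unique by blast
  moreover have "t + 1 = real (Suc \<nu>) + 1/2" by (simp add: t_def)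
  ultimately show ?thesis
    unfolding slope_term_def A_def[symmetric] B_def[symmetric] C_def[symmetric] t_def[symmetric]
    by (simp add: algebra_simps)
qed

text \<open>Both summands of \<open>telescoper_slope\<close> contain \<open>telescoper_root\<close>,
  which vanishes at 1/2: for \<open>n > 0\<close> through the kernel, for \<open>n = 0\<close>
  through the factor \<open>t - n - 1/2\<close>.\<close>

lemma telescoper_slope_start: "telescoper_slope n (1/2) = 0"
proof -
  have "telescoper_root n (1/2) = 0"
    using kernel_zero[of 0 n] by (cases n) (simp_all add: telescoper_root_def)
  then show ?thesis by (simp add: telescoper_slope_def)
qed

section \<open>Decay to the right of the poles\<close>

definition neg_log_deriv :: "nat \<Rightarrow> real \<Rightarrow> real" where
  "neg_log_deriv n t = (\<Sum>j\<le>n. 1 / (t - real j)) - (\<Sum>j<n. 1 / (t - real j - 1/2))"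

lemma neg_log_deriv_Suc: "neg_log_deriv (Suc n) t = neg_log_deriv n t + 1 / (t - real n - 1) - 1 / (t - real n - 1/2)"
  by (simp add: neg_log_deriv_def algebra_simps)

lemma kernel_deriv:
  assumes "t > real n"
  shows "(kernel n has_real_derivative - kernel n t * neg_log_deriv n t) (at t)"
  using assms
proof (induction n)
  case 0
  have "kernel 0 = (\<lambda>t. 1 / t)" by (simp add: kernel_0 fun_eq_iff)
  then show ?case using 0
    by (auto intro!: derivative_eq_intros simp: neg_log_deriv_def power2_eq_square)
next
  case (Suc n)
  have *: "kernel (Suc n) = (\<lambda>t. kernel n t * ((t - real n - 1/2) / (t - real n - 1)))"
    by (simp add: kernel_Suc fun_eq_iff)
  have nz: "t - real n - 1 \<noteq> 0" "t - real n - 1/2 \<noteq> 0" using Suc.prems by auto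
  have "((\<lambda>t. kernel n t * ((t - real n - 1/2) / (t - real n - 1))) has_real_derivative
     - kernel n t * neg_log_deriv n t * ((t - real n - 1/2) / (t - real n - 1)) +
     ((t - real n - 1) - (t - real n - 1/2)) / ((t - real n - 1) * (t - real n - 1)) * kernel n t) (at t)"
    using Suc nz by (intro DERIV_mult) (auto intro!: derivative_eq_intros)
  moreover have "- kernel n t * neg_log_deriv n t * ((t - real n - 1/2) / (t - real n - 1)) +
     ((t - real n - 1) - (t - real n - 1/2)) / ((t - real n - 1) * (t - real n - 1)) * kernel n t
     = - kernel (Suc n) t * neg_log_deriv (Suc n) t"
  proof -
    define x where "x = t - real n - 1"
    have x: "t - real n - 1 = x" "t - real n - 1/2 = x + 1/2" by (auto simp: x_def)
    have "x \<noteq> 0" "x + 1/2 \<noteq> 0" using nz by (auto simp: x_def)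
    then show ?thesis unfolding kernel_Suc neg_log_deriv_Suc x
      by (simp add: divide_simps) (simp add: algebra_simps)
  qed
  ultimately show ?case unfolding * by simp
qed

text \<open>Zeros and poles of the kernel interlace, so this is an alternating sum of terms of
  decreasing size whose largest term is \<open>1 / (t - n)\<close>.\<close>

lemma neg_log_deriv_bounds:
  assumes "t > real n"
  shows "0 \<le> neg_log_deriv n t" "neg_log_deriv n t \<le> 1 / (t - real n)"
proof -
  have "0 \<le> neg_log_deriv n t \<and> neg_log_deriv n t \<le> 1 / (t - real n)"
    using assms
  proof (induction n)
    case 0
    then show ?case by (simp add: neg_log_deriv_def)
  next
    case (Suc n)
    have "1 / (t - real n - 1/2) \<le> 1 / (t - real n - 1)" "1 / (t - real n) \<le> 1 / (t - real n - 1/2)"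
      using Suc.prems by (auto intro!: divide_left_mono)
    moreover have "1 / (t - real (Suc n)) = 1 / (t - real n - 1)" by (simp add: algebra_simps)
    moreover have "0 \<le> neg_log_deriv n t" "neg_log_deriv n t \<le> 1 / (t - real n)" using Suc by auto
    ultimately show ?case unfolding neg_log_deriv_Suc by linarith
  qed
  then show "0 \<le> neg_log_deriv n t" "neg_log_deriv n t \<le> 1 / (t - real n)" by auto
qed

lemma kernel_tendsto: "((\<lambda>t. t * kernel n t) \<longlongrightarrow> 1) at_top"
proof (induction n)
  case 0
  have "\<forall>\<^sub>F t in at_top. t * kernel 0 t = 1"
    using eventually_gt_at_top[of 0] by eventually_elim (simp add: kernel_0)
  then show ?case by (rule tendsto_eventually)
next
  case (Suc n)
  have "((\<lambda>t. (t - real n - 1/2) / (t - real n - 1)) \<longlongrightarrow> 1) at_top" by real_asymp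
  from tendsto_mult[OF Suc this] show ?case by (simp add: kernel_Suc mult.assoc)
qed

lemma telescoper_root_tendsto: "((\<lambda>t. t * telescoper_root n t) \<longlongrightarrow> 1) at_top"
proof -
  have "((\<lambda>t. t * (t - real n - 1/2) / ((t - real n - 1) * (t - real n - 2))) \<longlongrightarrow> 1) at_top"
    by real_asymp
  from tendsto_mult[OF kernel_tendsto this] show ?thesis by (simp add: telescoper_root_def mult.assoc)
qed

lemma telescoper_root_deriv:
  assumes "t > real n + 2"
  shows "(telescoper_root n has_real_derivative
     telescoper_root n t * (1/t + 1/(t - real n - 1/2) - 1/(t - real n - 1) - 1/(t - real n - 2) - neg_log_deriv n t)) (at t)"
proof -
  have *: "telescoper_root n = (\<lambda>t. kernel n t * (t * (t - real n - 1/2) / ((t - real n - 1) * (t - real n - 2))))"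
    by (simp add: telescoper_root_def fun_eq_iff)
  have K: "(kernel n has_real_derivative - kernel n t * neg_log_deriv n t) (at t)"
    using assms by (intro kernel_deriv) auto
  have "((\<lambda>t. kernel n t * (t * (t - real n - 1/2) / ((t - real n - 1) * (t - real n - 2)))) has_real_derivative
     - kernel n t * neg_log_deriv n t * (t * (t - real n - 1/2) / ((t - real n - 1) * (t - real n - 2))) +
     (((t - real n - 1/2) + t) * ((t - real n - 1) * (t - real n - 2)) -
       t * (t - real n - 1/2) * ((t - real n - 2) + (t - real n - 1)))
      / (((t - real n - 1) * (t - real n - 2)) * ((t - real n - 1) * (t - real n - 2))) * kernel n t) (at t)"
    using assms K by (intro DERIV_mult) (auto intro!: derivative_eq_intros)
  moreover have "- kernel n t * neg_log_deriv n t * (t * (t - real n - 1/2) / ((t - real n - 1) * (t - real n - 2))) +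
     (((t - real n - 1/2) + t) * ((t - real n - 1) * (t - real n - 2)) -
       t * (t - real n - 1/2) * ((t - real n - 2) + (t - real n - 1)))
      / (((t - real n - 1) * (t - real n - 2)) * ((t - real n - 1) * (t - real n - 2))) * kernel n t
    = telescoper_root n t * (1/t + 1/(t - real n - 1/2) - 1/(t - real n - 1) - 1/(t - real n - 2) - neg_log_deriv n t)"
  proof -
    have nz: "t \<noteq> 0" "t - real n - 1/2 \<noteq> 0" "t - real n - 1 \<noteq> 0" "t - real n - 2 \<noteq> 0"
      using assms by auto
    \<comment> \<open>The identity survives when the linear factors are replaced by independent
      variables, which keeps the algebra small.\<close>
    have gen: "- k * l * (t * p / (q * r)) + ((p + t) * (q * r) - t * p * (r + q)) / ((q * r) * (q * r)) * k
      = k * (t * p / (q * r)) * (1/t + 1/p - 1/q - 1/r - l)"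
      if "t \<noteq> 0" "p \<noteq> 0" "q \<noteq> 0" "r \<noteq> 0" for k l t p q r :: real
      using that by (simp add: divide_simps) (simp add: algebra_simps)
    show ?thesis unfolding telescoper_root_def by (rule gen[OF nz])
  qed
  ultimately show ?thesis unfolding * by simp
qed

text \<open>The squared root decays like \<open>1 / t\<^sup>2\<close>. It multiplies a factor linear
  in \<open>t\<close> times a logarithmic derivative tending to 0, minus a constant.\<close>

lemma telescoper_slope_tendsto: "(telescoper_slope n \<longlongrightarrow> 0) at_top"
proof -
  define lam where "lam t = 1/t + 1/(t - real n - 1/2) - 1/(t - real n - 1) - 1/(t - real n - 2) - neg_log_deriv n t" for t
  have l0: "(neg_log_deriv n \<longlongrightarrow> 0) at_top"
  proof (rule tendsto_sandwich)
    show "\<forall>\<^sub>F t in at_top. 0 \<le> neg_log_deriv n t" "\<forall>\<^sub>F t in at_top. neg_log_deriv n t \<le> 1 / (t - real n)"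
      using eventually_gt_at_top[of "real n"] by (eventually_elim, simp add: neg_log_deriv_bounds)+
    show "((\<lambda>t. 1 / (t - real n)) \<longlongrightarrow> 0) at_top" by real_asymp
  qed simp
  have "((\<lambda>t. 1/t + 1/(t - real n - 1/2) - 1/(t - real n - 1) - 1/(t - real n - 2)) \<longlongrightarrow> 0) at_top"
    by real_asymp
  from tendsto_diff[OF this l0] have lam: "(lam \<longlongrightarrow> 0) at_top" by (simp add: lam_def[abs_def])
  have q: "((\<lambda>t. telescoper_factor n t / t\<^sup>2) \<longlongrightarrow> 0) at_top"
    unfolding telescoper_factor_def by real_asymp
  have c: "((\<lambda>t. (2 * real n + 3) / 2 / t\<^sup>2) \<longlongrightarrow> 0) at_top" by real_asymp
  have "((\<lambda>t. (t * telescoper_root n t)\<^sup>2 * (telescoper_factor n t / t\<^sup>2 * lam t - (2 * real n + 3) / 2 / t\<^sup>2)) \<longlongrightarrow> 1\<^sup>2 * (0 * 0 - 0)) at_top"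
    by (intro tendsto_intros telescoper_root_tendsto q c lam)
  moreover have "\<forall>\<^sub>F t in at_top. telescoper_slope n t = (t * telescoper_root n t)\<^sup>2 * (telescoper_factor n t / t\<^sup>2 * lam t - (2 * real n + 3) / 2 / t\<^sup>2)"
    using eventually_gt_at_top[of "real n + 2"]
  proof eventually_elim
    case (elim t)
    have "deriv (telescoper_root n) t = telescoper_root n t * lam t"
      unfolding lam_def using telescoper_root_deriv[OF elim] by (rule DERIV_imp_deriv)
    moreover have "t \<noteq> 0" using elim by auto
    ultimately show ?case by (simp add: telescoper_slope_def field_simps power2_eq_square)
  qed
  ultimately show ?thesis by (simp add: tendsto_cong)
qed

text \<open>Keep the distance \<open>x\<close> to the last pole fixed and let \<open>n\<close> grow:
  each step multiplies the square by at most \<open>(y + 1/2) / (y + 3/2)\<close> with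
  \<open>y = x + n\<close>, and this product telescopes.\<close>

lemma kernel_square_bound:
  fixes x :: real
  assumes "x > 0"
  shows "(kernel n (real n + x))\<^sup>2 \<le> (x + 1/2) / (x\<^sup>2 * (x + real n + 1/2))"
proof (induction n)
  case 0
  have "x + 1/2 \<noteq> 0" using assms by simp
  then show ?case using assms by (simp add: kernel_0 power_divide)
next
  case (Suc n)
  define y where "y = x + real n"
  have y: "y > 0" using assms by (simp add: y_def)
  have step: "kernel (Suc n) (real (Suc n) + x) = kernel n (real n + x) * ((y + 1/2) / (y + 1))"
  proof -
    have *: "(\<Prod>j\<le>Suc n. real (Suc n) + x - real j) = (y + 1) * (\<Prod>j\<le>n. real n + x - real j)"
      by (subst prod.atMost_Suc_shift) (simp add: y_def algebra_simps)
    have **: "(\<Prod>j<Suc n. real (Suc n) + x - real j - 1/2) = (y + 1/2) * (\<Prod>j<n. real n + x - real j - 1/2)"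
      by (subst prod.lessThan_Suc_shift) (simp add: y_def algebra_simps)
    show ?thesis unfolding kernel_def * ** by (simp add: mult.commute)
  qed
  \<comment> \<open>Equivalent to \<open>(y + 1/2) * (y + 3/2) \<le> (y + 1)\<^sup>2\<close>, where
    the sides differ by 1/4.\<close>
  have le: "((y + 1/2) / (y + 1))\<^sup>2 \<le> (y + 1/2) / (y + 3/2)"
    using y by (simp add: divide_simps power2_eq_square) (simp add: algebra_simps)
  have "(kernel (Suc n) (real (Suc n) + x))\<^sup>2 = (kernel n (real n + x))\<^sup>2 * ((y + 1/2) / (y + 1))\<^sup>2"
    by (simp only: step power_mult_distrib)
  also have "\<dots> \<le> (x + 1/2) / (x\<^sup>2 * (y + 1/2)) * ((y + 1/2) / (y + 3/2))"
    using Suc le y assms unfolding y_def by (intro mult_mono) auto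
  also have "\<dots> = (x + 1/2) / (x\<^sup>2 * (x + real (Suc n) + 1/2))"
    using y assms by (simp add: divide_simps y_def) (simp add: algebra_simps)
  finally show ?case .
qed

lemma slope_term_bounds:
  "0 \<le> slope_term n (m + n)" "slope_term n (m + n) \<le> 8 / (real n + 1) * (1 / (real m + 1)\<^sup>2)"
proof -
  define x where "x = real m + 1/2"
  have x: "x > 0" by (simp add: x_def)
  have t: "real (m + n) + 1/2 = real n + x" by (simp add: x_def)
  have "deriv (kernel n) (real n + x) = - kernel n (real n + x) * neg_log_deriv n (real n + x)"
    using x by (intro DERIV_imp_deriv kernel_deriv) auto
  then have d: "slope_term n (m + n) = (kernel n (real n + x))\<^sup>2 * neg_log_deriv n (real n + x)"
    unfolding slope_term_def t by (simp add: power2_eq_square)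
  have l: "0 \<le> neg_log_deriv n (real n + x)" "neg_log_deriv n (real n + x) \<le> 1 / x"
    using neg_log_deriv_bounds[of n "real n + x"] x by auto
  show "0 \<le> slope_term n (m + n)" using d l by simp
  have "slope_term n (m + n) \<le> (x + 1/2) / (x\<^sup>2 * (x + real n + 1/2)) * (1 / x)"
    unfolding d using l x kernel_square_bound[OF x, of n] by (intro mult_mono) auto
  also have "\<dots> = (1 / (real m + real n + 1)) * ((real m + 1) / x ^ 3)"
    by (simp add: x_def power2_eq_square power3_eq_cube mult_ac add_ac)
  \<comment> \<open>The constant 8 comes from \<open>x \<ge> (m + 1) / 2\<close>. The bound now
    separates into a factor in \<open>n\<close> and a summable factor in \<open>m\<close>.\<close>
  also have "\<dots> \<le> (1 / (real n + 1)) * ((real m + 1) / ((real m + 1) / 2) ^ 3)"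
    by (intro mult_mono divide_left_mono power_mono mult_pos_pos zero_less_power) (auto simp: x_def)
  also have "\<dots> = 8 / (real n + 1) * (1 / (real m + 1)\<^sup>2)"
    by (simp add: divide_simps power2_eq_square power3_eq_cube)
  finally show "slope_term n (m + n) \<le> 8 / (real n + 1) * (1 / (real m + 1)\<^sup>2)" .
qed

lemma summable_inverse_squares: "summable (\<lambda>m. 1 / (real m + 1)\<^sup>2)"
  using summable_Suc_iff[THEN iffD2, OF inverse_power_summable[of 2, where 'a = real]]
  by (simp add: divide_inverse add.commute)

lemma slope_term_summable: "summable (slope_term n)"
proof -
  have "summable (\<lambda>m. slope_term n (m + n))"
    by (rule summable_comparison_test'[OF summable_mult[OF summable_inverse_squares, of "8 / (real n + 1)"], of 0])
       (use slope_term_bounds in auto)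
  then show ?thesis by simp
qed

section \<open>The series \<open>d\<^sub>n\<close>: size and recurrence\<close>

definition slope_series :: "nat \<Rightarrow> real" where
  "slope_series n = (\<Sum>\<nu>. slope_term n \<nu>)"

lemma slope_series_bounds:
  "0 \<le> slope_series n" "slope_series n \<le> 8 / (real n + 1) * (\<Sum>m. 1 / (real m + 1)\<^sup>2)"
proof -
  \<comment> \<open>A simple zero of the kernel suffices, as \<open>slope_term\<close> has the
    kernel itself as a factor. The sum thus starts at \<open>n\<close>, where
    \<open>slope_term_bounds\<close> applies.\<close>
  have "slope_term n \<nu> = 0" if "\<nu> < n" for \<nu>
    using kernel_zero[OF that] by (simp add: slope_term_def)
  then have e: "slope_series n = (\<Sum>m. slope_term n (m + n))"
    unfolding slope_series_def using suminf_split_initial_segment[OF slope_term_summable, of n n] by simp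
  have s: "summable (\<lambda>m. slope_term n (m + n))" using slope_term_summable by simp
  show "0 \<le> slope_series n" unfolding e by (rule suminf_nonneg[OF s slope_term_bounds(1)])
  have "slope_series n \<le> (\<Sum>m. 8 / (real n + 1) * (1 / (real m + 1)\<^sup>2))"
    unfolding e by (intro suminf_le slope_term_bounds s summable_mult summable_inverse_squares)
  then show "slope_series n \<le> 8 / (real n + 1) * (\<Sum>m. 1 / (real m + 1)\<^sup>2)"
    by (simp only: suminf_mult[OF summable_inverse_squares])
qed

text \<open>Summation over \<open>\<nu>\<close> telescopes, and the boundary terms at 1/2 and at
  infinity are both zero.\<close>

lemma slope_series_recurrence:
  "2 * (real n + 2)^3 * slope_series (n + 2)
     - (2 * real n + 3) * (2 * (real n)^2 + 6 * real n + 5) * slope_series (n + 1)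
     + 2 * (real n + 1)^3 * slope_series n = 0"
proof -
  have "(\<lambda>\<nu>. 2 * (real n + 2)^3 * slope_term (n + 2) \<nu>
     - (2 * real n + 3) * (2 * (real n)^2 + 6 * real n + 5) * slope_term (n + 1) \<nu>
     + 2 * (real n + 1)^3 * slope_term n \<nu>) sums
    (2 * (real n + 2)^3 * slope_series (n + 2)
     - (2 * real n + 3) * (2 * (real n)^2 + 6 * real n + 5) * slope_series (n + 1)
     + 2 * (real n + 1)^3 * slope_series n)"
    unfolding slope_series_def by (intro sums_add sums_diff sums_mult summable_sums slope_term_summable)
  moreover have "(\<lambda>\<nu>. telescoper_slope n (real \<nu> + 1/2) - telescoper_slope n (real (Suc \<nu>) + 1/2)) sums (telescoper_slope n (real 0 + 1/2) - 0)"
  proof (rule telescope_sums')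
    have "filterlim (\<lambda>\<nu>. real \<nu> + 1/2) at_top sequentially" by real_asymp
    with telescoper_slope_tendsto show "(\<lambda>\<nu>. telescoper_slope n (real \<nu> + 1/2)) \<longlonglongrightarrow> 0" by (rule filterlim_compose)
  qed
  ultimately show ?thesis
    unfolding slope_term_telescope using sums_unique2 telescoper_slope_start[of n] by force
qed

section \<open>The value \<zeta>(3) and the initial values of \<open>d\<^sub>n\<close>\<close>

definition zeta3 :: real where
  "zeta3 = (\<Sum>n. 1 / (real n + 1)^3)"

lemma zeta3_sums: "(\<lambda>n. 1 / (real n + 1)^3) sums zeta3"
proof -
  have "summable (\<lambda>n. 1 / (real n + 1)^3)"
    using summable_Suc_iff[THEN iffD2, OF inverse_power_summable[of 3, where 'a = real]]
    by (simp add: divide_inverse add.commute)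
  then show ?thesis unfolding zeta3_def by (rule summable_sums)
qed

text \<open>The point 3 lies in the half-plane of convergence, so \<open>riemann_zeta\<close> is
  given there by the Dirichlet series.\<close>

lemma riemann_zeta_3: "riemann_zeta 3 = complex_of_real zeta3"
proof -
  have "1 / complex_of_nat (Suc n) powr 3 = complex_of_real (1 / (real n + 1)^3)" for n
  proof -
    have "complex_of_nat (Suc n) powr of_nat 3 = complex_of_nat (Suc n) ^ 3"
      by (rule powr_nat')  auto
    then show ?thesis by (simp add: add.commute)
  qed
  then have "riemann_zeta 3 = (\<Sum>n. complex_of_real (1 / (real n + 1)^3))"
    by (simp add: riemann_zeta_def zeta_series_def)
  also have "\<dots> = complex_of_real zeta3"
    using sums_of_real[OF zeta3_sums, where 'a = complex] by (simp add: sums_iff)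
  finally show ?thesis .
qed

text \<open>Eight times the sum over odd bases: group the series for \<zeta>(3) into pairs of an odd
  and an even base, multiply by 8, and subtract the even part, which is \<zeta>(3) again.\<close>

lemma half_integer_cubes_sums: "(\<lambda>\<nu>. 1 / (real \<nu> + 1/2)^3) sums (7 * zeta3)"
proof -
  have "(\<lambda>n. \<Sum>i\<in>{n * 2..<n * 2 + 2}. 1 / (real i + 1)^3) sums zeta3"
    by (rule sums_group[OF zeta3_sums]) simp
  moreover have "{n * 2..<n * 2 + 2} = {2 * n, 2 * n + 1}" for n :: nat by auto
  ultimately have "(\<lambda>n. 1 / (2 * real n + 1)^3 + 1 / (2 * real n + 2)^3) sums zeta3"
    by (simp add: add.commute mult.commute)
  from sums_diff[OF sums_mult[OF this, of 8] zeta3_sums]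
  have "(\<lambda>n. 8 * (1 / (2 * real n + 1)^3 + 1 / (2 * real n + 2)^3) - 1 / (real n + 1)^3) sums (7 * zeta3)"
    by simp
  moreover have "8 * (1 / (2 * real n + 1)^3 + 1 / (2 * real n + 2)^3) - 1 / (real n + 1)^3
      = 1 / (real n + 1/2)^3" for n
  proof -
    have "(2 * real n + 2)^3 = 8 * (real n + 1)^3" "(2 * real n + 1)^3 = 8 * (real n + 1/2)^3"
      by (simp_all add: power3_eq_cube algebra_simps)
    then show ?thesis by simp
  qed
  ultimately show ?thesis by simp
qed

lemma slope_series_0: "slope_series 0 = 7 * zeta3"
proof -
  have "slope_term 0 \<nu> = 1 / (real \<nu> + 1/2)^3" for \<nu>
  proof -
    have "deriv (kernel 0) (real \<nu> + 1/2) = - kernel 0 (real \<nu> + 1/2) * neg_log_deriv 0 (real \<nu> + 1/2)"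
      by (intro DERIV_imp_deriv kernel_deriv) auto
    then show ?thesis by (simp add: slope_term_def kernel_0 neg_log_deriv_def power3_eq_cube)
  qed
  then have "slope_term 0 = (\<lambda>\<nu>. 1 / (real \<nu> + 1/2)^3)" by (simp add: fun_eq_iff)
  then show ?thesis unfolding slope_series_def using half_integer_cubes_sums by (simp add: sums_iff)
qed

lemma slope_series_1: "slope_series 1 = 7 / 2 * zeta3 - 1"
proof -
  \<comment> \<open>Partial fractions of \<open>slope_term 1\<close> at
    \<open>t = \<nu> + 1/2\<close>: index \<open>Suc \<nu>\<close> gives powers of
    \<open>1 / t\<close>, index \<open>\<nu>\<close> those of \<open>1 / (t - 1)\<close>. The
    rational part -1 of the sum comes from \<open>f 0 = -8\<close> and
    \<open>g 0 = 4\<close>.\<close>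
  define f where "f = (\<lambda>\<nu>::nat. 1 / (real \<nu> - 1/2)^3)"
  define g where "g = (\<lambda>\<nu>::nat. 1 / (real \<nu> - 1/2)^2)"
  have t: "slope_term 1 \<nu> = 1/4 * (f (Suc \<nu>) + f \<nu> + (g \<nu> - g (Suc \<nu>)))" for \<nu>
  proof -
    define t where "t = real \<nu> + 1/2"
    have nz: "t \<noteq> 0" "t - 1 \<noteq> 0"
      using not_Ints_nonzero[OF half_nat_not_Ints[of \<nu>]]
        diff_of_nat_nonzero[OF half_nat_not_Ints[of \<nu>], of 0] by (auto simp: t_def)
    have *: "kernel 1 = (\<lambda>t. 1 / t * ((t - 1/2) / (t - 1)))"
      using kernel_Suc[of 0] by (simp add: kernel_0 fun_eq_iff)
    have "(kernel 1 has_real_derivative - 1 / t\<^sup>2 * ((t - 1/2) / (t - 1)) +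
       ((t - 1) - (t - 1/2)) / ((t - 1) * (t - 1)) * (1 / t)) (at t)"
      unfolding * using nz
      by (intro DERIV_mult) (auto intro!: derivative_eq_intros simp: power2_eq_square)
    then have "deriv (kernel 1) t = - 1 / t\<^sup>2 * ((t - 1/2) / (t - 1)) +
       ((t - 1) - (t - 1/2)) / ((t - 1) * (t - 1)) * (1 / t)" by (rule DERIV_imp_deriv)
    then have "slope_term 1 \<nu> = - (1 / t * ((t - 1/2) / (t - 1))) * (- 1 / t\<^sup>2 * ((t - 1/2) / (t - 1)) +
       ((t - 1) - (t - 1/2)) / ((t - 1) * (t - 1)) * (1 / t))"
      unfolding slope_term_def t_def[symmetric] by (simp only: *)
    also have "\<dots> = 1/4 * (1 / t^3 + 1 / (t - 1)^3 + (1 / (t - 1)^2 - 1 / t^2))"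
      using nz by (simp add: divide_simps power2_eq_square power3_eq_cube) (simp add: algebra_simps)
    finally show ?thesis by (simp add: f_def g_def t_def add.commute)
  qed
  have f1: "(\<lambda>\<nu>. f (Suc \<nu>)) sums (7 * zeta3)"
    using half_integer_cubes_sums by (simp add: f_def add.commute)
  then have f0: "f sums (7 * zeta3 + f 0)" by (rule sums_Suc)
  have "g \<longlonglongrightarrow> 0" unfolding g_def by real_asymp
  then have "(\<lambda>\<nu>. g \<nu> - g (Suc \<nu>)) sums (g 0 - 0)" by (rule telescope_sums')
  with f0 f1 have "slope_term 1 sums (1/4 * (7 * zeta3 + (7 * zeta3 + f 0) + (g 0 - 0)))"
    unfolding t by (intro sums_mult sums_add)
  then have "slope_series 1 = 1/4 * (7 * zeta3 + (7 * zeta3 + f 0) + (g 0 - 0))"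
    unfolding slope_series_def by (simp add: sums_iff)
  then show ?thesis by (simp add: f_def g_def power2_eq_square power3_eq_cube)
qed

lemma recurrence_unique:
  fixes u :: "nat \<Rightarrow> real"
  assumes rec: "\<And>n. (real n + 2)^3 * u (n + 2)
            - 8 * (2 * real n + 3) * (2 * (real n)^2 + 6 * real n + 5) * u (n + 1)
            + 256 * (real n + 1)^3 * u n = 0"
    and "u 0 = 0" "u 1 = 0"
  shows "u n = 0"
proof -
  have "u n = 0 \<and> u (Suc n) = 0"
  proof (induction n)
    case 0
    then show ?case using assms by simp
  next
    case (Suc n)
    have "(real n + 2)^3 * u (n + 2) = 0" using rec[of n] Suc by simp
    moreover have "(real n + 2)^3 \<noteq> 0" by auto
    ultimately show ?case using Suc by auto
  qed
  then show ?thesis by simp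
qed

section \<open>The convolution of squared central binomial ratios\<close>

text \<open>This is \<open>p\<^sub>k = binom(2k, k) / 4\<^sup>k\<close>; the product form makes the
  quotient of successive values explicit.\<close>

definition binom_ratio :: "nat \<Rightarrow> real" where
  "binom_ratio k = (\<Prod>j<k. (real j + 1/2) / (real j + 1))"

lemma binom_ratio_0: "binom_ratio 0 = 1" and binom_ratio_Suc: "binom_ratio (Suc k) = binom_ratio k * ((real k + 1/2) / (real k + 1))"
  by (simp_all add: binom_ratio_def)

lemma binom_ratio_square_lower:
  assumes "k \<ge> 1"
  shows "1 / (4 * real k) \<le> (binom_ratio k)\<^sup>2"
  using assms
proof (induction k rule: dec_induct)
  case base
  then show ?case by (simp add: binom_ratio_def power2_eq_square)
next
  case (step k)
  \<comment> \<open>Amounts to \<open>k * (k + 1) \<le> (k + 1/2)\<^sup>2\<close>.\<close>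
  have "1 / (4 * real (Suc k)) \<le> 1 / (4 * real k) * ((real k + 1/2) / (real k + 1))\<^sup>2"
    using step.hyps by (simp add: divide_simps power2_eq_square) (simp add: algebra_simps)
  also have "\<dots> \<le> (binom_ratio k)\<^sup>2 * ((real k + 1/2) / (real k + 1))\<^sup>2"
    by (intro mult_right_mono step.IH) simp
  finally show ?case by (simp only: binom_ratio_Suc power_mult_distrib)
qed

definition binom_conv :: "nat \<Rightarrow> real" where
  "binom_conv n = (\<Sum>k\<le>n. (binom_ratio k * binom_ratio (n - k))\<^sup>2)"

text \<open>The certificate at \<open>t = k\<close> telescopes, and its lower boundary term vanishes
  through the factor \<open>k\<close> at \<open>k = 0\<close>. The range stops at \<open>n\<close>,
  beyond which \<open>n - k\<close> would be truncated subtraction.\<close>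

lemma binom_conv_partial_sum:
  assumes "K \<le> n"
  shows "(\<Sum>k\<le>K. 2 * (real n + 2)^3 * (binom_ratio k * binom_ratio (n + 2 - k))\<^sup>2
      - (2 * real n + 3) * (2 * (real n)^2 + 6 * real n + 5) * (binom_ratio k * binom_ratio (n + 1 - k))\<^sup>2
      + 2 * (real n + 1)^3 * (binom_ratio k * binom_ratio (n - k))\<^sup>2)
    = telescoper_factor n (real K + 1) * ((real K + 1/2) / (real n - real K + 1) * (binom_ratio K * binom_ratio (n - K)))\<^sup>2"
proof -
  define w where "w k = binom_ratio k * binom_ratio (n - k) / ((real k - real n - 1) * (real k - real n - 2))" for k
  define T where "T k = 2 * (real n + 2)^3 * (binom_ratio k * binom_ratio (n + 2 - k))\<^sup>2
      - (2 * real n + 3) * (2 * (real n)^2 + 6 * real n + 5) * (binom_ratio k * binom_ratio (n + 1 - k))\<^sup>2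
      + 2 * (real n + 1)^3 * (binom_ratio k * binom_ratio (n - k))\<^sup>2" for k
  have T: "T k = telescoper_factor n (real k + 1) * ((real k + 1/2) * (real k - real n - 2) * w k)\<^sup>2
      - telescoper_factor n (real k) * (real k * (real k - real n - 1/2) * w k)\<^sup>2" if "k \<le> n" for k
  proof -
    obtain m where m: "n = k + m" using \<open>k \<le> n\<close> unfolding le_iff_add by blast
    have k0: "binom_ratio k * binom_ratio (n - k) = (real k - real n - 1) * (real k - real n - 2) * w k"
      by (simp add: w_def m)
    have k1: "binom_ratio k * binom_ratio (n + 1 - k) = (real k - real n - 1/2) * (real k - real n - 2) * w k"
      by (simp add: w_def m binom_ratio_Suc divide_simps) (simp add: algebra_simps)
    have k2: "binom_ratio k * binom_ratio (n + 2 - k) = (real k - real n - 1/2) * (real k - real n - 3/2) * w k"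
      by (simp add: w_def m binom_ratio_Suc numeral_2_eq_2 divide_simps) (simp add: algebra_simps)
    show ?thesis unfolding T_def k0 k1 k2 telescoper_factor_def by (rule telescoping_certificate)
  qed
  have "(\<Sum>k\<le>K. T k) = telescoper_factor n (real K + 1) * ((real K + 1/2) * (real K - real n - 2) * w K)\<^sup>2"
    using assms
  proof (induction K)
    case 0
    then show ?case by (simp add: T)
  next
    case (Suc K)
    obtain m where m: "n = Suc K + m" using Suc.prems unfolding le_iff_add by blast
    have "n - K = Suc m" by (simp add: m)
    \<comment> \<open>The lower root at \<open>Suc K\<close> equals the upper root at
      \<open>K\<close>, so consecutive terms cancel.\<close>
    then have "real (Suc K) * (real (Suc K) - real n - 1/2) * w (Suc K) = (real K + 1/2) * (real K - real n - 2) * w K"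
      by (simp add: w_def m binom_ratio_Suc divide_simps) (simp add: algebra_simps)
    then show ?case using Suc by (simp add: T add.commute)
  qed
  also have "(real K + 1/2) * (real K - real n - 2) * w K = - ((real K + 1/2) / (real n - real K + 1) * (binom_ratio K * binom_ratio (n - K)))"
  proof -
    have "real n - real K + 1 > 0" using assms by simp
    then have "real K - real n - 2 \<noteq> 0" "real K - real n - 1 = - (real n - real K + 1)" by auto
    moreover have "x * y * (c / (v * y)) = - (x / z * c)" if "y \<noteq> 0" "v = - z" for c v x y z :: real
      using that by simp
    ultimately show ?thesis unfolding w_def by blast
  qed
  finally show ?thesis unfolding T_def by simp
qed

text \<open>The partial sum up to \<open>n\<close> leaves a boundary term; it cancels against the
  summands \<open>k = n + 1\<close> and \<open>k = n + 2\<close> of the two longer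
  convolutions.\<close>

lemma binom_conv_recurrence:
  "2 * (real n + 2)^3 * binom_conv (n + 2)
     - (2 * real n + 3) * (2 * (real n)^2 + 6 * real n + 5) * binom_conv (n + 1)
     + 2 * (real n + 1)^3 * binom_conv n = 0"
proof -
  define A where "A = 2 * (real n + 2)^3"
  define B where "B = (2 * real n + 3) * (2 * (real n)^2 + 6 * real n + 5)"
  define C where "C = 2 * (real n + 1)^3"
  have c2: "binom_conv (n + 2) = (\<Sum>k\<le>n. (binom_ratio k * binom_ratio (n + 2 - k))\<^sup>2) + (binom_ratio (n + 1) * binom_ratio 1)\<^sup>2 + (binom_ratio (n + 2) * binom_ratio 0)\<^sup>2"
    by (simp add: binom_conv_def numeral_2_eq_2)
  have c1: "binom_conv (n + 1) = (\<Sum>k\<le>n. (binom_ratio k * binom_ratio (n + 1 - k))\<^sup>2) + (binom_ratio (n + 1) * binom_ratio 0)\<^sup>2"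
    by (simp add: binom_conv_def)
  have "A * binom_conv (n + 2) - B * binom_conv (n + 1) + C * binom_conv n
     = (\<Sum>k\<le>n. A * (binom_ratio k * binom_ratio (n + 2 - k))\<^sup>2 - B * (binom_ratio k * binom_ratio (n + 1 - k))\<^sup>2 + C * (binom_ratio k * binom_ratio (n - k))\<^sup>2)
       + (A * ((binom_ratio (n + 1) * binom_ratio 1)\<^sup>2 + (binom_ratio (n + 2) * binom_ratio 0)\<^sup>2) - B * (binom_ratio (n + 1) * binom_ratio 0)\<^sup>2)"
    unfolding c1 c2 binom_conv_def[of n]
    by (simp add: sum.distrib sum_subtractf sum_distrib_left algebra_simps)
  also have "\<dots> = telescoper_factor n (real n + 1) * ((real n + 1/2) * binom_ratio n)\<^sup>2
       + (A * ((binom_ratio (n + 1) * binom_ratio 1)\<^sup>2 + (binom_ratio (n + 2) * binom_ratio 0)\<^sup>2) - B * (binom_ratio (n + 1) * binom_ratio 0)\<^sup>2)"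
    unfolding A_def B_def C_def by (subst binom_conv_partial_sum) (simp_all add: binom_ratio_0)
  also have "\<dots> = 0"
  proof -
    \<comment> \<open>Everything left is a rational multiple of \<open>p\<^sup>2\<close>.\<close>
    define p where "p = binom_ratio (n + 1)"
    have p: "(real n + 1/2) * binom_ratio n = (real n + 1) * p"
      by (simp add: p_def binom_ratio_Suc)
    have c2: "binom_ratio (n + 2) = p * ((real n + 3/2) / (real n + 2))"
      using binom_ratio_Suc[of "n + 1"] by (simp add: p_def numeral_2_eq_2 add_ac)
    have c1: "binom_ratio 1 = 1/2" by (simp add: binom_ratio_def)
    show ?thesis
      unfolding p p_def[symmetric] A_def B_def telescoper_factor_def binom_ratio_0 c1 c2
      by (simp add: divide_simps) (simp add: algebra_simps power2_eq_square power3_eq_cube)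
  qed
  finally show ?thesis unfolding A_def B_def C_def .
qed

lemma binom_conv_lower:
  assumes "n \<ge> 2"
  shows "ln (real n) / (16 * real n) \<le> binom_conv n"
proof -
  \<comment> \<open>Without its two end summands the convolution has \<open>k\<close> running from 1
    to \<open>n - 1\<close>, and \<open>harm (n - 1)\<close> still dominates \<open>ln n\<close>.
    Each summand is at least \<open>1 / (16 k (n - k))\<close>, hence at least
    \<open>1 / (16 k n)\<close>.\<close>
  have "ln (real n) = ln (real (n - 1) + 1)" using assms by (simp add: of_nat_diff)
  also have "\<dots> \<le> harm (n - 1)" by (rule ln_le_harm)
  also have "\<dots> = (\<Sum>k=1..n-1. 1 / real k)" by (simp add: harm_def divide_inverse)
  finally have "ln (real n) / (16 * real n) \<le> (\<Sum>k=1..n-1. 1 / real k) / (16 * real n)"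
    using assms by (intro divide_right_mono) auto
  also have "\<dots> = (\<Sum>k=1..n-1. 1 / real k / (16 * real n))" by (rule sum_divide_distrib)
  also have "\<dots> \<le> (\<Sum>k=1..n-1. (binom_ratio k * binom_ratio (n - k))\<^sup>2)"
  proof (rule sum_mono)
    fix k assume k: "k \<in> {1..n-1}"
    then have nk: "n - k \<ge> 1" by auto
    have "1 / real k / (16 * real n) \<le> 1 / (4 * real k) * (1 / (4 * real (n - k)))"
      using k nk by (simp add: divide_simps)
    also have "\<dots> \<le> (binom_ratio k)\<^sup>2 * (binom_ratio (n - k))\<^sup>2"
      using k nk by (intro mult_mono binom_ratio_square_lower) auto
    finally show "1 / real k / (16 * real n) \<le> (binom_ratio k * binom_ratio (n - k))\<^sup>2"
      by (simp add: power_mult_distrib)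
  qed
  also have "\<dots> \<le> binom_conv n"
    unfolding binom_conv_def by (rule sum_mono2) auto
  finally show ?thesis .
qed

section \<open>Rescaling and comparison with \<open>a\<close> and \<open>b\<close>\<close>

lemma scaled_recurrence:
  fixes c :: "nat \<Rightarrow> real"
  assumes "2 * (real n + 2)^3 * c (n + 2)
     - (2 * real n + 3) * (2 * (real n)^2 + 6 * real n + 5) * c (n + 1)
     + 2 * (real n + 1)^3 * c n = 0"
  shows "(real n + 2)^3 * (16 ^ (n + 2) * c (n + 2))
     - 8 * (2 * real n + 3) * (2 * (real n)^2 + 6 * real n + 5) * (16 ^ (n + 1) * c (n + 1))
     + 256 * (real n + 1)^3 * (16 ^ n * c n) = 0"
proof -
  have "(real n + 2)^3 * (16 ^ (n + 2) * c (n + 2))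
     - 8 * (2 * real n + 3) * (2 * (real n)^2 + 6 * real n + 5) * (16 ^ (n + 1) * c (n + 1))
     + 256 * (real n + 1)^3 * (16 ^ n * c n)
     = 128 * 16 ^ n * (2 * (real n + 2)^3 * c (n + 2)
     - (2 * real n + 3) * (2 * (real n)^2 + 6 * real n + 5) * c (n + 1)
     + 2 * (real n + 1)^3 * c n)"
    by (simp add: ring_distribs)
  then show ?thesis unfolding assms by simp
qed

theorem theorem5:
  fixes a b :: "nat \<Rightarrow> real"
  assumes a_rec: "\<And>n. (real n + 2)^3 * a (n + 2)
            - 8 * (2 * real n + 3) * (2 * (real n)^2 + 6 * real n + 5) * a (n + 1)
            + 256 * (real n + 1)^3 * a n = 0"
    and b_rec: "\<And>n. (real n + 2)^3 * b (n + 2)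
            - 8 * (2 * real n + 3) * (2 * (real n)^2 + 6 * real n + 5) * b (n + 1)
            + 256 * (real n + 1)^3 * b n = 0"
    and "a 0 = 1" and "a 1 = 8" and "b 0 = 0" and "b 1 = 1"
  shows "\<exists>C::real. \<forall>\<^sub>F n in sequentially.
           cmod (complex_of_real (b n / a n) - 7 / 16 * riemann_zeta 3) \<le> C * (1 / ln (real n))"
proof -
  have a: "a n = 16 ^ n * binom_conv n" for n
  proof -
    define u where "u n = 16 ^ n * binom_conv n - a n" for n
    have "u n = 0"
    proof (rule recurrence_unique)
      fix n
      show "(real n + 2)^3 * u (n + 2)
            - 8 * (2 * real n + 3) * (2 * (real n)^2 + 6 * real n + 5) * u (n + 1)
            + 256 * (real n + 1)^3 * u n = 0"
        using scaled_recurrence[OF binom_conv_recurrence[of n]] a_rec[of n]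
        unfolding u_def right_diff_distrib by linarith
    qed (use assms in \<open>simp_all add: u_def binom_conv_def binom_ratio_def power2_eq_square\<close>)
    then show ?thesis by (simp add: u_def)
  qed
  have d: "7 / 16 * zeta3 * a n - b n = 16 ^ n * slope_series n / 16" for n
  proof -
    \<comment> \<open>The combination is fixed by the initial values: \<zeta>(3) cancels at 0 and at
      1, and \<open>16 * b 1\<close> cancels the -1 in \<open>slope_series 1\<close>.\<close>
    define u where "u n = 16 ^ n * slope_series n + 16 * b n - 7 * zeta3 * a n" for n
    have "u n = 0"
    proof (rule recurrence_unique)
      fix n
      define A where "A = (real n + 2)^3"
      define B where "B = 8 * (2 * real n + 3) * (2 * (real n)^2 + 6 * real n + 5)"
      define C where "C = 256 * (real n + 1)^3"
      have "A * u (n + 2) - B * u (n + 1) + C * u n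
        = (A * (16 ^ (n + 2) * slope_series (n + 2)) - B * (16 ^ (n + 1) * slope_series (n + 1)) + C * (16 ^ n * slope_series n))
          + 16 * (A * b (n + 2) - B * b (n + 1) + C * b n)
          - 7 * zeta3 * (A * a (n + 2) - B * a (n + 1) + C * a n)"
        unfolding u_def by (simp only: ring_distribs) (simp only: mult_ac add_ac diff_conv_add_uminus minus_add_distrib minus_minus)
      also have "\<dots> = 0"
        unfolding A_def B_def C_def a_rec b_rec scaled_recurrence[OF slope_series_recurrence] by simp
      finally show "(real n + 2)^3 * u (n + 2)
            - 8 * (2 * real n + 3) * (2 * (real n)^2 + 6 * real n + 5) * u (n + 1)
            + 256 * (real n + 1)^3 * u n = 0"
        unfolding A_def B_def C_def .
    qed (use slope_series_0 slope_series_1 assms in \<open>simp_all add: u_def\<close>)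
    then show ?thesis by (simp add: u_def)
  qed
  define K where "K = (\<Sum>m. 1 / (real m + 1)\<^sup>2)"
  have "cmod (complex_of_real (b n / a n) - 7 / 16 * riemann_zeta 3) \<le> 8 * K * (1 / ln (real n))"
    if n: "n \<ge> 2" for n
  proof -
    have ln: "ln (real n) > 0" using n by simp
    have "ln (real n) / (16 * real n) > 0" using n ln by simp
    then have c: "binom_conv n > 0" using binom_conv_lower[OF n] by linarith
    have "K \<ge> 0" unfolding K_def by (intro suminf_nonneg summable_inverse_squares) simp
    have "complex_of_real (b n / a n) - 7 / 16 * riemann_zeta 3 = complex_of_real (b n / a n - 7 / 16 * zeta3)"
      by (simp add: riemann_zeta_3)
    then have "cmod (complex_of_real (b n / a n) - 7 / 16 * riemann_zeta 3) = \<bar>b n / a n - 7 / 16 * zeta3\<bar>"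
      by (simp only: norm_of_real)
    \<comment> \<open>The powers of 16 cancel, leaving the quotient of \<open>d\<^sub>n / 16\<close>
      and the convolution.\<close>
    also have "b n / a n - 7 / 16 * zeta3 = - (slope_series n / 16 / binom_conv n)"
      using d[of n] a[of n] c by (simp add: field_simps)
    also have "\<bar>\<dots>\<bar> = slope_series n / 16 / binom_conv n"
      using slope_series_bounds(1)[of n] c by simp
    \<comment> \<open>Numerator and denominator are both of scale \<open>1 / n\<close>; only the
      logarithm from the lower bound survives.\<close>
    also have "\<dots> \<le> (8 / real n * K) / 16 / (ln (real n) / (16 * real n))"
    proof (intro frac_le divide_right_mono)
      have "slope_series n \<le> 8 / (real n + 1) * K" using slope_series_bounds(2) by (simp add: K_def)
      also have "\<dots> \<le> 8 / real n * K"
        using n \<open>K \<ge> 0\<close> by (intro mult_right_mono divide_left_mono) auto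
      finally show "slope_series n \<le> 8 / real n * K" .
    qed (use binom_conv_lower[OF n] ln n \<open>K \<ge> 0\<close> in auto)
    also have "\<dots> = 8 * K * (1 / ln (real n))" using n by simp
    finally show ?thesis .
  qed
  then show ?thesis
    by (intro exI[of _ "8 * K"] eventually_mono[OF eventually_ge_at_top[of 2]])
qed

end
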